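(* Let $H$ be an infinite-dimensional separable complex Hilbert space. Let $\Lambda\subseteq[0,\infty)$ be a bounded countable set, well-ordered by the usual order of $\mathbb{R}$, and let $(P_\lambda)_{\lambda\in\Lambda}$ be mutually orthogonal projections on $H$ with $\sum_{\lambda\in\Lambda}P_\lambda=I$ in the strong operator topology. Suppose $K\in\mathcal{B}(H)$ is a positive compact operator with $KP_\lambda=P_\lambda K$ and $K|_{R(P_\lambda)}\le\lambda I_{R(P_\lambda)}$ for all $\lambda\in\Lambda$. Then the operator $$T=\sum_{\lambda\in\Lambda}\lambda P_\lambda-K$$ (series in the strong operator topology) is positive and belongs to $\mathcal{M}_r(H)$.
   Context: $\mathcal{B}(H)$ denotes the bounded linear operators on $H$; $R(P)$ is the range of $P$; projections are orthogonal projections; for self-adjoint $A,B$, $A\le B$ means $B-A$ is positive, i.e. $\langle (B-A)x,x\rangle\ge0$ for all $x$. For a nonzero Hilbert space $M$ and $A\in\mathcal{B}(M)$, the minimum modulus is $m(A)=\inf\{\|Ax\|: x\in M,\ \|x\|=1\}$; $A$ is minimum attaining if there is a unit vector $x_0\in M$ with $\|Ax_0\|=m(A)$. A closed subspace $M\subseteq H$ reduces $T\in\mathcal{B}(H)$ if $T(M)\subseteq M$ and $T^*(M)\subseteq M$. $\mathcal{M}_r(H)$ is the set of all $T\in\mathcal{B}(H)$ such that for every nonzero closed subspace $M$ reducing $T$, the restriction $T|_M:M\to M$ is minimum attaining. *)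

theory Defs
  imports "HOL-Analysis.Analysis"
begin

text \<open>A complex inner product space is a real one (for the real part of the complex inner product)
  together with its complex structure, so the library's norm, topology, and limits apply.
  The complex inner product is linear in its first argument.\<close>

class complex_inner = real_inner +
  fixes scaleC :: "complex \<Rightarrow> 'a \<Rightarrow> 'a"  (infixr \<open>*\<^sub>C\<close> 75)
    and cinner :: "'a \<Rightarrow> 'a \<Rightarrow> complex"
  assumes scaleC_add_right: "c *\<^sub>C (x + y) = c *\<^sub>C x + c *\<^sub>C y"
    and scaleC_add_left: "(c + d) *\<^sub>C x = c *\<^sub>C x + d *\<^sub>C x"
    and scaleC_scaleC: "c *\<^sub>C d *\<^sub>C x = (c * d) *\<^sub>C x"
    and scaleC_of_real: "complex_of_real r *\<^sub>C x = r *\<^sub>R x"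
    and cinner_commute: "cinner x y = cnj (cinner y x)"
    and cinner_add_left: "cinner (x + y) z = cinner x z + cinner y z"
    and cinner_scaleC_left: "cinner (c *\<^sub>C x) y = c * cinner x y"
    and Re_cinner: "Re (cinner x y) = inner x y"

class complex_hilbert = complex_inner + complete_space

global_interpretation complex_vector: vector_space "scaleC :: complex \<Rightarrow> 'a \<Rightarrow> 'a::complex_inner"
  defines csubspace = complex_vector.subspace
    and cspan = complex_vector.span
proof unfold_locales
  show "1 *\<^sub>C x = x" for x :: 'a
    using scaleC_of_real[of 1 x] by simp
qed (simp_all add: scaleC_add_right scaleC_add_left scaleC_scaleC)

lemma cinner_self: "cinner x x = complex_of_real ((norm x)\<^sup>2)"
proof (rule complex_eqI)
  show "Re (cinner x x) = Re (complex_of_real ((norm x)\<^sup>2))"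
    by (simp add: Re_cinner power2_norm_eq_inner)
  have "Im (cinner x x) = - Im (cinner x x)"
    using arg_cong[OF cinner_commute[of x x], of Im] by (simp only: complex_cnj cnj.simps)
  then show "Im (cinner x x) = Im (complex_of_real ((norm x)\<^sup>2))"
    by simp
qed

definition bounded_clinear :: "('a::complex_inner \<Rightarrow> 'a) \<Rightarrow> bool"
  where "bounded_clinear T \<longleftrightarrow> bounded_linear T \<and> (\<forall>c x. T (c *\<^sub>C x) = c *\<^sub>C T x)"

definition cadjoint :: "('a::complex_inner \<Rightarrow> 'a) \<Rightarrow> ('a \<Rightarrow> 'a)"
  where "cadjoint T = (SOME S. \<forall>x y. cinner (T x) y = cinner x (S y))"

text \<open>On a Hilbert space the adjoint exists (Riesz), so the choice above is not arbitrary.\<close>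

lemma riesz_real:
  fixes f :: "'a::{real_inner, complete_space} \<Rightarrow> real"
  assumes f: "bounded_linear f"
  shows "\<exists>z. \<forall>x. f x = inner x z"
proof -
  interpret f: bounded_linear f by fact
  define g where "g x = inner x x - 2 * f x" for x
  obtain C where C: "\<And>x. \<bar>f x\<bar> \<le> norm x * C" using f.bounded by auto
  have lower: "- C\<^sup>2 \<le> g x" for x
  proof -
    have "0 \<le> (norm x - C)\<^sup>2" by simp
    then have "2 * (norm x * C) \<le> (norm x)\<^sup>2 + C\<^sup>2" by (simp add: power2_diff)
    then show ?thesis using C[of x] unfolding g_def by (simp add: power2_norm_eq_inner)
  qed
  define m where "m = (INF x. g x)"
  have bdd: "bdd_below (range g)" using lower by (intro bdd_belowI2)
  have m_le: "m \<le> g x" for x unfolding m_def by (rule cINF_lower[OF bdd]) simp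
  have "\<exists>x. g x < m + inverse (real (Suc n))" for n
    using cINF_less_iff[OF _ bdd, of "m + inverse (real (Suc n))"] by (auto simp: m_def)
  then obtain X where X: "\<And>n. g (X n) < m + inverse (real (Suc n))" by metis
  have par: "(norm (a - b))\<^sup>2 \<le> 2 * (g a + g b - 2 * m)" for a b
  proof -
    have "g a + g b - 2 * g ((1/2) *\<^sub>R (a + b)) = (norm (a - b))\<^sup>2 / 2"
      unfolding g_def power2_norm_eq_inner f.scaleR f.add
      by (simp add: inner_add inner_diff algebra_simps inner_commute)
    then show ?thesis using m_le[of "(1/2) *\<^sub>R (a + b)"] by simp
  qed
  have "Cauchy X"
  proof (rule metric_CauchyI)
    fix e :: real assume "0 < e"
    then obtain N where N: "inverse (real (Suc N)) < e\<^sup>2 / 4"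
      using reals_Archimedean[of "e\<^sup>2 / 4"] by auto
    have small: "g (X k) < m + e\<^sup>2 / 4" if "k \<ge> N" for k
    proof -
      have "inverse (real (Suc k)) \<le> inverse (real (Suc N))" using that by (simp add: field_simps)
      then show ?thesis using X[of k] N by linarith
    qed
    have "dist (X k) (X l) < e" if "k \<ge> N" "l \<ge> N" for k l
    proof -
      have "(norm (X k - X l))\<^sup>2 < e\<^sup>2"
        using par[of "X k" "X l"] small[OF that(1)] small[OF that(2)] by (simp add: field_simps)
      then show ?thesis using \<open>0 < e\<close> by (simp add: dist_norm power2_less_imp_less)
    qed
    then show "\<exists>M. \<forall>k\<ge>M. \<forall>l\<ge>M. dist (X k) (X l) < e" by blast
  qed
  then obtain z where z: "X \<longlonglongrightarrow> z"
    using Cauchy_convergent convergent_def by blast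
  have "(\<lambda>n. g (X n)) \<longlonglongrightarrow> g z"
    unfolding g_def by (intro tendsto_intros z f.tendsto)
  moreover have "(\<lambda>n. m + inverse (real (Suc n))) \<longlonglongrightarrow> m + 0"
    by (intro tendsto_intros LIMSEQ_inverse_real_of_nat)
  ultimately have "g z \<le> m + 0"
    using X by (intro LIMSEQ_le[of "\<lambda>n. g (X n)"]) (auto intro: less_imp_le)
  then have min: "g z \<le> g x" for x using m_le[of x] by simp
  have "f x = inner x z" for x
  proof (rule ccontr)
    define d where "d = f x - inner x z"
    assume "f x \<noteq> inner x z"
    then have "d \<noteq> 0" by (simp add: d_def)
    have ineq: "0 \<le> t\<^sup>2 * inner x x - 2 * t * d" for t
      using min[of "z + t *\<^sub>R x"] unfolding g_def d_def f.add f.scaleR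
      by (simp add: inner_add inner_commute algebra_simps power2_eq_square)
    define q where "q = inner x x + 1"
    have q: "q > 0" by (simp add: q_def add_nonneg_pos)
    define s where "s = d / q"
    have d: "d = s * q" using q by (simp add: s_def)
    then have "s \<noteq> 0" using \<open>d \<noteq> 0\<close> by auto
    have "s\<^sup>2 * inner x x - 2 * s * d = - (s\<^sup>2 * (q + 1))"
      unfolding d by (simp add: q_def algebra_simps power2_eq_square)
    moreover have "s\<^sup>2 * (q + 1) > 0" using q \<open>s \<noteq> 0\<close> by simp
    ultimately show False using ineq[of s] by simp
  qed
  then show ?thesis by blast
qed

lemma cinner_cadjoint:
  fixes T :: "'a::complex_hilbert \<Rightarrow> 'a"
  assumes T: "bounded_clinear T"
  shows "cinner (T x) y = cinner x (cadjoint T y)"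
proof -
  have "\<exists>z. \<forall>x. cinner (T x) y = cinner x z" for y
  proof -
    have "bounded_linear (\<lambda>x. inner (T x) y)"
      using T by (simp add: bounded_clinear_def bounded_linear_inner_left_comp)
    then obtain z where z: "\<And>x. inner (T x) y = inner x z" using riesz_real by blast
    have Re: "Re (cinner (T x) y) = Re (cinner x z)" for x by (simp add: Re_cinner z)
    have "Im (cinner (T x) y) = Im (cinner x z)" for x
      using Re[of "\<i> *\<^sub>C x"] T by (simp add: bounded_clinear_def cinner_scaleC_left)
    with Re have "cinner (T x) y = cinner x z" for x by (simp add: complex_eqI)
    then show ?thesis by blast
  qed
  then have "\<exists>S. \<forall>x y. cinner (T x) y = cinner x (S y)" by metis
  then show ?thesis unfolding cadjoint_def by (rule someI2_ex) blast
qed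

definition is_projection :: "('a::complex_inner \<Rightarrow> 'a) \<Rightarrow> bool"
  where "is_projection P \<longleftrightarrow> bounded_clinear P \<and> P \<circ> P = P \<and> cadjoint P = P"

text \<open>\<open>op_le_on M A B\<close> is the order \<open>A \<le> B\<close> between the restrictions of \<open>A\<close> and \<open>B\<close> to the
  subspace \<open>M\<close>.  The membership in the nonnegative reals includes that the value is real.\<close>

definition op_le_on :: "'a::complex_inner set \<Rightarrow> ('a \<Rightarrow> 'a) \<Rightarrow> ('a \<Rightarrow> 'a) \<Rightarrow> bool"
  where "op_le_on M A B \<longleftrightarrow> (\<forall>x\<in>M. cinner (B x - A x) x \<in> \<real>\<^sub>\<ge>\<^sub>0)"

definition positive_op :: "('a::complex_inner \<Rightarrow> 'a) \<Rightarrow> bool"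
  where "positive_op A \<longleftrightarrow> bounded_clinear A \<and> op_le_on UNIV (\<lambda>x. 0) A"

definition compact_op :: "('a::complex_inner \<Rightarrow> 'a) \<Rightarrow> bool"
  where "compact_op K \<longleftrightarrow> bounded_clinear K \<and> compact (closure (K ` cball 0 1))"

text \<open>Convergence of the net of finite partial sums in the strong operator topology,
  i.e. pointwise on vectors.\<close>

definition sot_has_sum :: "('i \<Rightarrow> 'a \<Rightarrow> 'a) \<Rightarrow> 'i set \<Rightarrow> ('a::complex_inner \<Rightarrow> 'a) \<Rightarrow> bool"
  where "sot_has_sum F I S \<longleftrightarrow> (\<forall>x. ((\<lambda>i. F i x) has_sum S x) I)"

text \<open>The next two notions concern the restriction of \<open>A\<close> to a nonzero subspace \<open>M\<close>.\<close>

definition min_modulus_on :: "'a::complex_inner set \<Rightarrow> ('a \<Rightarrow> 'a) \<Rightarrow> real"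
  where "min_modulus_on M A = Inf {norm (A x) | x. x \<in> M \<and> norm x = 1}"

definition min_attaining_on :: "'a::complex_inner set \<Rightarrow> ('a \<Rightarrow> 'a) \<Rightarrow> bool"
  where "min_attaining_on M A \<longleftrightarrow> (\<exists>x0\<in>M. norm x0 = 1 \<and> norm (A x0) = min_modulus_on M A)"

definition reduces :: "'a::complex_inner set \<Rightarrow> ('a \<Rightarrow> 'a) \<Rightarrow> bool"
  where "reduces M T \<longleftrightarrow> T ` M \<subseteq> M \<and> cadjoint T ` M \<subseteq> M"

definition M_r :: "('a::complex_inner \<Rightarrow> 'a) set"
  where "M_r = {T. bounded_clinear T \<and>
    (\<forall>M. csubspace M \<and> closed M \<and> M \<noteq> {0} \<and> reduces M T \<longrightarrow> min_attaining_on M T)}"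

end

theory Submission
  imports Defs
begin

text \<open>Let \<open>\<mu>\<close> be the bottom of the numerical range of \<open>T\<close> on the reducing subspace \<open>M\<close>; any
  eigenvector in \<open>M\<close> for the value \<open>\<mu>\<close> attains the minimum modulus.  Put \<open>A = T - \<mu>\<close>, so that
  \<open>A \<ge> 0\<close> on \<open>M\<close>, whereas \<open>A \<le> 0\<close> on the range of \<open>P\<^sub>\<lambda>\<close> for every \<open>\<lambda> \<le> \<mu>\<close>, because \<open>K \<ge> 0\<close>.
  Since \<open>P\<^sub>\<lambda>\<close> commutes with \<open>A\<close>, this difference of signs forces \<open>A P\<^sub>\<lambda> = 0\<close> on \<open>M\<close>.  If \<open>P\<^sub>\<lambda>\<close> does not
  vanish on \<open>M\<close> for some such \<open>\<lambda>\<close>, then \<open>(I - s A)\<^sup>n x\<close>, with \<open>x \<in> M\<close>, \<open>P\<^sub>\<lambda> x \<noteq> 0\<close> and \<open>s > 0\<close> small,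
  converges along even \<open>n\<close> to an element of the kernel of \<open>A\<close> with the same nonzero image under \<open>P\<^sub>\<lambda>\<close>.
  Otherwise only the \<open>\<lambda> > \<mu>\<close> contribute to \<open>M\<close>; by well-ordering they stay away from \<open>\<mu>\<close>, so
  \<open>\<Sum>\<lambda> P\<^sub>\<lambda> - \<mu>\<close> is bounded below on \<open>M\<close> and the compactness of \<open>K\<close> makes a minimizing sequence
  converge along a subsequence.\<close>

section \<open>Iteration of \<open>I - s A\<close> for a bounded symmetric operator on a real
  Hilbert space\<close>

locale symmetric_operator = bounded_linear A
  for A :: "'a::{real_inner, complete_space} \<Rightarrow> 'a" +
  fixes s :: real
  assumes symmetric: "inner (A x) y = inner x (A y)"
    and s_pos: "s > 0"
    and small: "s * norm (A x) \<le> norm x"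
begin

text \<open>A gradient step for the quadratic form of \<open>A\<close>. By \<open>small\<close>, the
  step size \<open>s\<close> is at most the inverse of the norm of \<open>A\<close>, so
  \<open>H\<close> does not overshoot on subspaces where \<open>A\<close> is nonnegative. Its fixed
  points are the kernel of \<open>A\<close>.\<close>

definition H :: "'a \<Rightarrow> 'a"
  where "H x = x - s *\<^sub>R A x"

lemma bounded_linear_H: "bounded_linear H"
  unfolding H_def by (intro bounded_linear_intros bounded_linear_axioms)

lemma symmetric_H: "inner (H x) y = inner x (H y)"
  by (simp add: H_def inner_diff symmetric)

lemma symmetric_H_pow: "inner ((H ^^ n) x) y = inner x ((H ^^ n) y)"
  by (induction n arbitrary: x y) (simp_all add: symmetric_H funpow_swap1)

lemma A_H_pow: "A ((H ^^ n) x) = (H ^^ n) (A x)"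
  by (induction n) (simp_all add: H_def diff scaleR)

lemma H_pow_mem:
  assumes "subspace V" "\<And>x. x \<in> V \<Longrightarrow> A x \<in> V" "x \<in> V"
  shows "(H ^^ n) x \<in> V"
  using assms by (induction n) (auto simp: H_def intro: subspace_diff subspace_scale)

lemma norm_H_sq: "(norm (H x))\<^sup>2 = (norm x)\<^sup>2 - 2 * s * inner (A x) x + s\<^sup>2 * (norm (A x))\<^sup>2"
  unfolding H_def power2_norm_eq_inner
  by (simp add: inner_diff inner_commute power2_eq_square algebra_simps)

text \<open>This is the form inequality between \<open>s A A\<close> and \<open>A\<close>, obtained
  without a square root of \<open>A\<close>: nonnegativity is tested at \<open>H x\<close> instead
  of \<open>x\<close>, and the term of third order in \<open>A\<close> is absorbed by
  \<open>small\<close>.\<close>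

lemma norm_A_sq_le:
  assumes V: "subspace V" "\<And>x. x \<in> V \<Longrightarrow> A x \<in> V"
    and pos: "\<And>x. x \<in> V \<Longrightarrow> 0 \<le> inner (A x) x" and x: "x \<in> V"
  shows "s * (norm (A x))\<^sup>2 \<le> inner (A x) x"
proof -
  have "H x \<in> V" using H_pow_mem[OF V x, of 1] by simp
  then have "0 \<le> inner (A (H x)) (H x)" by (rule pos)
  also have "\<dots> = inner (A x) x - 2 * s * inner (A x) (A x) + s\<^sup>2 * inner (A (A x)) (A x)"
    unfolding H_def diff scaleR
    by (simp add: inner_diff symmetric power2_eq_square algebra_simps inner_commute)
  finally have "2 * s * (norm (A x))\<^sup>2 \<le> inner (A x) x + s\<^sup>2 * inner (A (A x)) (A x)"
    by (simp add: power2_norm_eq_inner)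
  moreover have "s\<^sup>2 * inner (A (A x)) (A x) \<le> s * (norm (A x))\<^sup>2"
  proof -
    have "inner (A (A x)) (A x) \<le> norm (A (A x)) * norm (A x)" by (rule norm_cauchy_schwarz)
    then have "s * inner (A (A x)) (A x) \<le> s * norm (A (A x)) * norm (A x)" using s_pos by simp
    also have "\<dots> \<le> norm (A x) * norm (A x)" by (intro mult_right_mono small) simp
    finally show ?thesis using s_pos by (simp add: power2_eq_square mult.assoc)
  qed
  ultimately show ?thesis by simp
qed

text \<open>In \<open>norm_H_sq\<close> the linear term occurs twice, and by
  \<open>norm_A_sq_le\<close> each copy dominates the quadratic term. One copy cancels that term;
  the other is the decrement, which later forces \<open>A z = 0\<close> for a limit \<open>z\<close>
  of the iteration.\<close>

lemma H_contraction:
  assumes "subspace V" "\<And>x. x \<in> V \<Longrightarrow> A x \<in> V"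
    and "\<And>x. x \<in> V \<Longrightarrow> 0 \<le> inner (A x) x" and "x \<in> V"
  shows "(norm (H x))\<^sup>2 \<le> (norm x)\<^sup>2 - s\<^sup>2 * (norm (A x))\<^sup>2"
proof -
  have "s * (s * (norm (A x))\<^sup>2) \<le> s * inner (A x) x"
    using norm_A_sq_le[OF assms] s_pos by simp
  then show ?thesis unfolding norm_H_sq by (simp add: power2_eq_square)
qed

lemma H_pow_antimono:
  assumes V: "subspace V" "\<And>x. x \<in> V \<Longrightarrow> A x \<in> V"
    and pos: "\<And>x. x \<in> V \<Longrightarrow> 0 \<le> inner (A x) x" and x: "x \<in> V" and "m \<le> n"
  shows "norm ((H ^^ n) x) \<le> norm ((H ^^ m) x)"
proof -
  have "norm ((H ^^ Suc n) x) \<le> norm ((H ^^ n) x)" for n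
  proof -
    have "0 \<le> s\<^sup>2 * (norm (A ((H ^^ n) x)))\<^sup>2" by simp
    then have "(norm (H ((H ^^ n) x)))\<^sup>2 \<le> (norm ((H ^^ n) x))\<^sup>2"
      using H_contraction[OF V pos H_pow_mem[OF V x, of n]] by linarith
    then have "norm (H ((H ^^ n) x)) \<le> norm ((H ^^ n) x)" by (rule power2_le_imp_le) simp
    then show ?thesis by simp
  qed
  then show ?thesis using \<open>m \<le> n\<close> by (rule lift_Suc_antimono_le)
qed

text \<open>The powers of \<open>H\<close> stay bounded on \<open>V\<close>, hence on its image under \<open>E\<close>, while on \<open>W\<close> each
  step adds at least \<open>s\<^sup>2 * (norm (A y))\<^sup>2\<close> to the squared norm.\<close>

lemma intertwiner_vanishes:
  assumes V: "subspace V" "\<And>x. x \<in> V \<Longrightarrow> A x \<in> V" "\<And>x. x \<in> V \<Longrightarrow> 0 \<le> inner (A x) x"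
    and W: "subspace W" "\<And>x. x \<in> W \<Longrightarrow> A x \<in> W" "\<And>x. x \<in> W \<Longrightarrow> inner (A x) x \<le> 0"
    and E: "bounded_linear E" "\<And>x. x \<in> V \<Longrightarrow> E x \<in> W" "\<And>x. E (A x) = A (E x)"
    and x: "x \<in> V"
  shows "A (E x) = 0"
proof (rule ccontr)
  assume ne: "A (E x) \<noteq> 0"
  define y where "y = E x"
  interpret E: bounded_linear E by (rule E)
  have y: "y \<in> W" using E x by (simp add: y_def)
  have EH: "E ((H ^^ n) x) = (H ^^ n) y" for n
    by (induction n) (simp_all add: H_def E.diff E.scaleR E y_def)
  obtain C where C: "\<And>x. norm (E x) \<le> norm x * C" and "C \<ge> 0"
    using E.nonneg_bounded by blast
  have step: "(norm z)\<^sup>2 + s\<^sup>2 * (norm (A z))\<^sup>2 \<le> (norm (H z))\<^sup>2" if "z \<in> W" for z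
    unfolding norm_H_sq using W(3)[OF that] s_pos by (simp add: mult_nonneg_nonpos)
  \<comment> \<open>This is needed for \<open>w = A y\<close>: as \<open>A\<close> commutes with
    \<open>H\<close>, it keeps the increments in \<open>grow\<close> from shrinking.\<close>
  have expand: "norm w \<le> norm ((H ^^ n) w)" if "w \<in> W" for n w
  proof (induction n)
    case (Suc n)
    have "0 \<le> s\<^sup>2 * (norm (A ((H ^^ n) w)))\<^sup>2" by simp
    then have "(norm ((H ^^ n) w))\<^sup>2 \<le> (norm (H ((H ^^ n) w)))\<^sup>2"
      using step[OF H_pow_mem[OF W(1,2) that, of n]] by linarith
    then have "norm ((H ^^ n) w) \<le> norm (H ((H ^^ n) w))" by (rule power2_le_imp_le) simp
    then show ?case using Suc by simp
  qed simp
  have grow: "(norm y)\<^sup>2 + real n * (s\<^sup>2 * (norm (A y))\<^sup>2) \<le> (norm ((H ^^ n) y))\<^sup>2" for n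
  proof (induction n)
    case (Suc n)
    have "(norm (A y))\<^sup>2 \<le> (norm (A ((H ^^ n) y)))\<^sup>2"
      unfolding A_H_pow by (intro power_mono expand W y) simp
    then have "s\<^sup>2 * (norm (A y))\<^sup>2 \<le> s\<^sup>2 * (norm (A ((H ^^ n) y)))\<^sup>2"
      by (rule mult_left_mono) simp
    then show ?case
      using Suc step[OF H_pow_mem[OF W(1,2) y, of n]] by (simp add: algebra_simps)
  qed simp
  have bound: "(norm ((H ^^ n) y))\<^sup>2 \<le> (norm x * C)\<^sup>2" for n
  proof (rule power_mono)
    have "norm ((H ^^ n) y) \<le> norm ((H ^^ n) x) * C" using C[of "(H ^^ n) x"] by (simp add: EH)
    also have "\<dots> \<le> norm x * C"
      using H_pow_antimono[OF V x, of 0 n] \<open>C \<ge> 0\<close> by (simp add: mult_right_mono)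
    finally show "norm ((H ^^ n) y) \<le> norm x * C" .
  qed simp
  have "s\<^sup>2 * (norm (A y))\<^sup>2 > 0" using ne s_pos by (simp add: y_def)
  then obtain n where "(norm x * C)\<^sup>2 < real n * (s\<^sup>2 * (norm (A y))\<^sup>2)"
    using reals_Archimedean3 by blast
  then show False using grow[of n] bound[of n] zero_le_power2[of "norm y"] by linarith
qed

text \<open>The even powers of \<open>H\<close> converge on \<open>V\<close> to the projection onto the kernel of \<open>A\<close>.\<close>

lemma kernel_vector:
  assumes V: "subspace V" "\<And>x. x \<in> V \<Longrightarrow> A x \<in> V" "\<And>x. x \<in> V \<Longrightarrow> 0 \<le> inner (A x) x"
    and cl: "closed V" and x: "x \<in> V"
    and E: "bounded_linear E" "\<And>x. x \<in> V \<Longrightarrow> E (A x) = 0"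
  shows "\<exists>z\<in>V. A z = 0 \<and> E z = E x"
proof -
  interpret E: bounded_linear E by (rule E)
  define y where "y n = (H ^^ (2 * n)) x" for n
  define d where "d n = (norm ((H ^^ n) x))\<^sup>2" for n
  have yV: "y n \<in> V" for n unfolding y_def by (rule H_pow_mem[OF V(1,2) x])
  have d_mono: "d n \<le> d m" if "m \<le> n" for m n
    unfolding d_def by (rule power_mono[OF H_pow_antimono[OF V x that] norm_ge_zero])
  \<comment> \<open>Here the even exponents matter: the total exponent \<open>2 * m + 2 * n\<close>
    splits into equal halves, so symmetry turns the mixed term into a squared norm. The Cauchy
    property then follows from the convergence of \<open>d\<close> alone.\<close>
  have dist_sq: "(norm (y m - y n))\<^sup>2 = d (2 * m) + d (2 * n) - 2 * d (m + n)" for m n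
  proof -
    have "inner ((H ^^ (2 * m)) x) ((H ^^ (2 * n)) x) = inner x ((H ^^ (2 * m + 2 * n)) x)"
      by (simp add: symmetric_H_pow funpow_add)
    also have "2 * m + 2 * n = (m + n) + (m + n)" by simp
    also have "inner x ((H ^^ \<dots>) x) = d (m + n)"
      unfolding funpow_add[of "m + n" "m + n"]
      by (simp add: symmetric_H_pow[symmetric] d_def power2_norm_eq_inner)
    finally show ?thesis
      unfolding y_def power2_norm_eq_inner
      by (simp add: inner_diff inner_commute d_def power2_norm_eq_inner)
  qed
  have "decseq d" using d_mono by (simp add: decseq_def)
  moreover have "0 \<le> d n" for n by (simp add: d_def)
  ultimately obtain L where L: "d \<longlonglongrightarrow> L" "\<And>n. L \<le> d n"
    using decseq_convergent[of d 0] by metis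
  have "Cauchy y"
  proof (rule metric_CauchyI)
    fix e :: real assume "0 < e"
    then have "\<forall>\<^sub>F n in sequentially. d n < L + e\<^sup>2 / 2"
      by (intro order_tendstoD(2)[OF L(1)]) simp
    then obtain N where N: "\<And>n. n \<ge> N \<Longrightarrow> d n < L + e\<^sup>2 / 2"
      unfolding eventually_sequentially by blast
    have "dist (y m) (y n) < e" if "m \<ge> N" "n \<ge> N" for m n
    proof -
      have "(norm (y m - y n))\<^sup>2 < e\<^sup>2"
        using dist_sq[of m n] L(2)[of "m + n"] N[of "2 * m"] N[of "2 * n"] that by simp
      then show ?thesis using \<open>0 < e\<close> by (simp add: dist_norm power2_less_imp_less)
    qed
    then show "\<exists>M. \<forall>m\<ge>M. \<forall>n\<ge>M. dist (y m) (y n) < e" by blast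
  qed
  then obtain z where z: "y \<longlonglongrightarrow> z" using Cauchy_convergent convergent_def by blast
  have zV: "z \<in> V" using closed_sequentially[OF cl _ z] yV by blast
  have lim: "(\<lambda>n. norm (y n)) \<longlonglongrightarrow> norm z" using z by (rule tendsto_norm)
  have "(\<lambda>n. norm (H (y n))) \<longlonglongrightarrow> norm (H z)"
    by (intro tendsto_norm bounded_linear.tendsto[OF bounded_linear_H] z)
  \<comment> \<open>The odd power lies between two even ones, so in the limit \<open>H\<close> does
    not decrease the norm of \<open>z\<close>. The decrement in \<open>H_contraction\<close> must
    therefore vanish.\<close>
  moreover have "norm (y (Suc n)) \<le> norm (H (y n))" for n
    using H_pow_antimono[OF V x, of "Suc (2 * n)" "2 * Suc n"] by (simp add: y_def)
  ultimately have "norm z \<le> norm (H z)"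
    using LIMSEQ_Suc[OF lim] by (intro LIMSEQ_le) auto
  then have "(norm z)\<^sup>2 \<le> (norm (H z))\<^sup>2" by (intro power_mono) simp_all
  then have "s\<^sup>2 * (norm (A z))\<^sup>2 \<le> 0" using H_contraction[OF V zV] by linarith
  then have "A z = 0" using s_pos by (simp add: mult_le_0_iff)
  moreover have "E z = E x"
  proof -
    have "E ((H ^^ n) x) = E x" for n
      by (induction n) (simp_all add: H_def E.diff E.scaleR E(2) H_pow_mem[OF V(1,2) x, unfolded H_def])
    then have "(\<lambda>n. E x) \<longlonglongrightarrow> E z" using E.tendsto[OF z] by (simp add: y_def)
    then show ?thesis by (simp add: LIMSEQ_const_iff)
  qed
  ultimately show ?thesis using zV by blast
qed

end

section \<open>Compact perturbation of an operator that is bounded below\<close>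

text \<open>Compactness makes \<open>K (X n)\<close> converge along a subsequence, hence also
  \<open>B (X n)\<close>, since the difference tends to zero. The lower bound for \<open>B\<close>
  on \<open>V\<close> carries the Cauchy property back to the vectors themselves.\<close>

lemma unit_kernel_vector_compact:
  fixes B K :: "'a::{real_inner, complete_space} \<Rightarrow> 'a"
  assumes B: "bounded_linear B" and K: "bounded_linear K" "compact (closure (K ` cball 0 1))"
    and V: "subspace V" "closed V"
    and d: "d > 0" "\<And>x. x \<in> V \<Longrightarrow> d * norm x \<le> norm (B x)"
    and X: "\<And>n. X n \<in> V" "\<And>n. norm (X n) = 1" "(\<lambda>n. B (X n) - K (X n)) \<longlonglongrightarrow> 0"
  shows "\<exists>z\<in>V. norm z = 1 \<and> B z = K z"
proof -
  interpret B: bounded_linear B by (rule B)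
  have "seq_compact (closure (K ` cball 0 1))" using K by (simp add: compact_imp_seq_compact)
  moreover have "K (X n) \<in> closure (K ` cball 0 1)" for n
    using closure_subset[of "K ` cball 0 1"] X(2)[of n] by auto
  ultimately have "\<exists>k\<in>closure (K ` cball 0 1). \<exists>r. strict_mono r \<and> (\<lambda>n. K (X (r n))) \<longlonglongrightarrow> k"
    unfolding seq_compact_def by (auto dest!: spec[of _ "\<lambda>n. K (X n)"] simp: comp_def)
  then obtain k r where r: "strict_mono r" and k: "(\<lambda>n. K (X (r n))) \<longlonglongrightarrow> k"
    by blast
  have BK: "(\<lambda>n. B (X (r n)) - K (X (r n))) \<longlonglongrightarrow> 0"
    using LIMSEQ_subseq_LIMSEQ[OF X(3) r] by (simp add: comp_def)
  have "(\<lambda>n. B (X (r n))) \<longlonglongrightarrow> k" using tendsto_add[OF BK k] by simp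
  then have cB: "Cauchy (\<lambda>n. B (X (r n)))" by (rule LIMSEQ_imp_Cauchy)
  have "Cauchy (\<lambda>n. X (r n))"
  proof (rule metric_CauchyI)
    fix e :: real assume "0 < e"
    then obtain N where N: "\<And>m n. m \<ge> N \<Longrightarrow> n \<ge> N \<Longrightarrow> dist (B (X (r m))) (B (X (r n))) < d * e"
      using metric_CauchyD[OF cB, of "d * e"] d(1) by auto
    have "dist (X (r m)) (X (r n)) < e" if "m \<ge> N" "n \<ge> N" for m n
    proof -
      have "d * norm (X (r m) - X (r n)) \<le> norm (B (X (r m) - X (r n)))"
        by (intro d subspace_diff V X)
      also have "\<dots> < d * e" using N[OF that] by (simp add: dist_norm B.diff)
      finally show ?thesis using d(1) by (simp add: dist_norm)
    qed
    then show "\<exists>M. \<forall>m\<ge>M. \<forall>n\<ge>M. dist (X (r m)) (X (r n)) < e" by blast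
  qed
  then obtain z where z: "(\<lambda>n. X (r n)) \<longlonglongrightarrow> z" using Cauchy_convergent convergent_def by blast
  have "z \<in> V" using closed_sequentially[OF V(2) _ z] X(1) by blast
  moreover have "norm z = 1"
    using tendsto_norm[OF z] X(2) by (simp add: LIMSEQ_const_iff)
  moreover have "B z - K z = 0"
    by (rule LIMSEQ_unique[OF tendsto_diff[OF B.tendsto[OF z] bounded_linear.tendsto[OF K(1) z]] BK])
  ultimately show ?thesis by auto
qed

section \<open>Orthogonal series and the diagonal operator of a resolution of the identity\<close>

text \<open>By Pythagoras, the squared norm of a finite tail is a tail of the sum of squares, so the
  net of finite partial sums is Cauchy and completeness applies.\<close>

lemma orthogonal_summable_on:
  fixes f :: "'i \<Rightarrow> 'a::{real_inner, complete_space}"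
  assumes orth: "pairwise (\<lambda>i j. orthogonal (f i) (f j)) A"
    and summ: "(\<lambda>i. (norm (f i))\<^sup>2) summable_on A"
  shows "f summable_on A"
proof -
  define g where "g i = (norm (f i))\<^sup>2" for i
  define t where "t = infsum g A"
  have t: "(g has_sum t) A" using summ by (simp add: g_def[abs_def] t_def)
  have "\<exists>Q. eventually Q (finite_subsets_at_top A) \<and>
      (\<forall>F F'. Q F \<and> Q F' \<longrightarrow> dist (sum f F) (sum f F') < e)" if e: "e > 0" for e
  proof -
    \<comment> \<open>Any bound strictly below the square of \<open>e / 2\<close> serves: partial
      sums beyond \<open>F0\<close> must lie within \<open>e / 2\<close> of the one over
      \<open>F0\<close>, so that two of them differ by less than \<open>e\<close>.\<close>
    obtain F0 where F0: "finite F0" "F0 \<subseteq> A" "dist (sum g F0) t \<le> e\<^sup>2 / 16"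
      using has_sum_finite_approximation[OF t, of "e\<^sup>2 / 16", OF divide_pos_pos] e
      by (metis zero_less_numeral zero_less_power)
    define Q where "Q F \<longleftrightarrow> finite F \<and> F0 \<subseteq> F \<and> F \<subseteq> A" for F
    have "eventually Q (finite_subsets_at_top A)"
      unfolding eventually_finite_subsets_at_top Q_def using F0 by blast
    moreover have near: "dist (sum f F) (sum f F0) < e / 2" if "Q F" for F
    proof -
      have F: "finite F" "F0 \<subseteq> F" "F \<subseteq> A" using that by (auto simp: Q_def)
      have "(norm (sum f F - sum f F0))\<^sup>2 = (norm (sum f (F - F0)))\<^sup>2"
        using F by (simp add: sum_diff)
      also have "\<dots> = sum g (F - F0)"
        unfolding g_def using F by (intro norm_sum_Pythagorean pairwise_subset[OF orth]) auto
      also have "\<dots> = sum g F - sum g F0" using F by (simp add: sum_diff)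
      also have "\<dots> \<le> t - sum g F0"
        using finite_sum_le_has_sum[OF t F(1,3)] by (simp add: g_def)
      also have "\<dots> < (e / 2)\<^sup>2"
      proof -
        have "t - sum g F0 \<le> e\<^sup>2 / 16" 
          using F0(3) abs_ge_minus_self[of "sum g F0 - t"] unfolding dist_real_def by linarith
        moreover have "0 < e\<^sup>2" using \<open>e > 0\<close> by simp
        moreover have "(e / 2)\<^sup>2 = e\<^sup>2 / 4" by (simp add: power_divide)
        ultimately show ?thesis by linarith
      qed
      finally have "norm (sum f F - sum f F0) < e / 2"
        by (rule power2_less_imp_less) (use \<open>e > 0\<close> in simp)
      then show ?thesis by (simp only: dist_norm)
    qed
    moreover have "dist (sum f F) (sum f F') < e" if "Q F" "Q F'" for F F'
      by (rule dist_triangle_half_l[OF near[OF that(1)] near[OF that(2)]])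
    ultimately show ?thesis by (intro exI[of _ Q]) simp
  qed
  then have "cauchy_filter (filtermap (sum f) (finite_subsets_at_top A))"
    by (simp add: cauchy_filter_metric_filtermap)
  moreover have "complete (UNIV :: 'a set)"
    by (meson Cauchy_convergent UNIV_I complete_def convergent_def)
  ultimately obtain L where "(sum f \<longlongrightarrow> L) (finite_subsets_at_top A)"
    using complete_uniform[where S = UNIV] by (force simp add: filterlim_def)
  then show ?thesis using summable_on_def has_sum_def by blast
qed

locale orthogonal_resolution =
  fixes \<Lambda> :: "real set" and P :: "real \<Rightarrow> 'a::{real_inner, complete_space} \<Rightarrow> 'a"
  assumes bounded_linear_P: "l \<in> \<Lambda> \<Longrightarrow> bounded_linear (P l)"
    and symmetric_P: "l \<in> \<Lambda> \<Longrightarrow> inner (P l x) y = inner x (P l y)"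
    and idem: "l \<in> \<Lambda> \<Longrightarrow> P l (P l x) = P l x"
    and orth: "l \<in> \<Lambda> \<Longrightarrow> m \<in> \<Lambda> \<Longrightarrow> l \<noteq> m \<Longrightarrow> P l (P m x) = 0"
    and P_has_sum: "((\<lambda>l. P l x) has_sum x) \<Lambda>"
    and bounded: "bounded \<Lambda>"
begin

lemma inner_P_self: "l \<in> \<Lambda> \<Longrightarrow> inner (P l x) x = (norm (P l x))\<^sup>2"
  using symmetric_P[of l x "P l x"] by (simp add: power2_norm_eq_inner idem inner_commute)

text \<open>Parseval's identity, from pairing the resolution of \<open>x\<close> with
  \<open>x\<close>.\<close>

lemma norm_sq_has_sum: "((\<lambda>l. (norm (P l x))\<^sup>2) has_sum (norm x)\<^sup>2) \<Lambda>"
proof -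
  have "((\<lambda>l. inner (P l x) x) has_sum inner x x) \<Lambda>"
    by (rule has_sum_bounded_linear[OF bounded_linear_inner_left P_has_sum])
  then show ?thesis
    unfolding power2_norm_eq_inner[of x] by (simp add: inner_P_self cong: has_sum_cong)
qed

text \<open>The infinite sum has a default value when the family is not summable;
  \<open>D_has_sum\<close> shows that this case never occurs.\<close>

definition D :: "'a \<Rightarrow> 'a"
  where "D x = (\<Sum>\<^sub>\<infinity>l\<in>\<Lambda>. l *\<^sub>R P l x)"

lemma orthogonal_P: "pairwise (\<lambda>l m. orthogonal (l *\<^sub>R P l x) (m *\<^sub>R P m x)) \<Lambda>"
  by (simp add: pairwise_def orthogonal_def symmetric_P orth)

lemma Lambda_bound:
  obtains C where "C > 0" "\<And>l. l \<in> \<Lambda> \<Longrightarrow> \<bar>l\<bar> \<le> C"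
  using bounded unfolding bounded_pos by auto

lemma norm_weighted_sq:
  assumes "\<bar>l\<bar> \<le> C"
  shows "(norm (l *\<^sub>R P l x))\<^sup>2 \<le> C\<^sup>2 * (norm (P l x))\<^sup>2"
  using power_mono[OF assms, of 2] by (simp add: power_mult_distrib mult_right_mono)

lemma D_has_sum: "((\<lambda>l. l *\<^sub>R P l x) has_sum D x) \<Lambda>"
proof -
  obtain C where C: "C > 0" "\<And>l. l \<in> \<Lambda> \<Longrightarrow> \<bar>l\<bar> \<le> C" using Lambda_bound by blast
  have "(\<lambda>l. C\<^sup>2 * (norm (P l x))\<^sup>2) summable_on \<Lambda>"
    using has_sum_cmult_right[OF norm_sq_has_sum] by (auto simp: summable_on_def)
  then have "(\<lambda>l. (norm (l *\<^sub>R P l x))\<^sup>2) summable_on \<Lambda>"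
    by (rule summable_on_comparison_test) (use norm_weighted_sq C in auto)
  then have "(\<lambda>l. l *\<^sub>R P l x) summable_on \<Lambda>"
    by (rule orthogonal_summable_on[OF orthogonal_P])
  then show ?thesis unfolding D_def by (rule has_sum_infsum)
qed

lemma D_inner_has_sum: "((\<lambda>l. l * inner (P l x) y) has_sum inner (D x) y) \<Lambda>"
  using has_sum_bounded_linear[OF bounded_linear_inner_left D_has_sum] by simp

lemma D_inner_self_has_sum: "((\<lambda>l. l * (norm (P l x))\<^sup>2) has_sum inner (D x) x) \<Lambda>"
  using D_inner_has_sum[of x x] by (simp add: inner_P_self cong: has_sum_cong)

lemma bounded_linear_D: "bounded_linear D"
proof -
  obtain C where C: "C > 0" "\<And>l. l \<in> \<Lambda> \<Longrightarrow> \<bar>l\<bar> \<le> C" using Lambda_bound by blast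
  note lin = linear_simps[OF bounded_linear_P]
  show ?thesis
  proof (rule bounded_linear_intro)
    fix x y :: 'a and r :: real
    have "((\<lambda>l. l *\<^sub>R P l (x + y)) has_sum (D x + D y)) \<Lambda>"
      using has_sum_add[OF D_has_sum D_has_sum]
      by (simp add: lin scaleR_add_right cong: has_sum_cong)
    then show "D (x + y) = D x + D y" using D_has_sum has_sum_unique by blast
    have "((\<lambda>l. l *\<^sub>R P l (r *\<^sub>R x)) has_sum (r *\<^sub>R D x)) \<Lambda>"
      using has_sum_scaleR[OF D_has_sum, of r x] by (simp add: lin mult.commute cong: has_sum_cong)
    then show "D (r *\<^sub>R x) = r *\<^sub>R D x" using D_has_sum has_sum_unique by blast
    have fin: "norm (\<Sum>l\<in>F. l *\<^sub>R P l x) \<le> norm x * C" if F: "finite F" "F \<subseteq> \<Lambda>" for F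
    proof -
      have "(norm (\<Sum>l\<in>F. l *\<^sub>R P l x))\<^sup>2 = (\<Sum>l\<in>F. (norm (l *\<^sub>R P l x))\<^sup>2)"
        using F by (intro norm_sum_Pythagorean pairwise_subset[OF orthogonal_P])
      also have "\<dots> \<le> (\<Sum>l\<in>F. C\<^sup>2 * (norm (P l x))\<^sup>2)"
        by (intro sum_mono norm_weighted_sq C) (use F in auto)
      also have "\<dots> = C\<^sup>2 * (\<Sum>l\<in>F. (norm (P l x))\<^sup>2)" by (simp add: sum_distrib_left)
      also have "\<dots> \<le> C\<^sup>2 * (norm x)\<^sup>2"
        by (intro mult_left_mono finite_sum_le_has_sum[OF norm_sq_has_sum]) (use F in auto)
      also have "\<dots> = (norm x * C)\<^sup>2" by (simp add: power_mult_distrib mult.commute)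
      finally show ?thesis by (rule power2_le_imp_le) (use C in simp)
    qed
    have "((\<lambda>F. norm (\<Sum>l\<in>F. l *\<^sub>R P l x)) \<longlongrightarrow> norm (D x)) (finite_subsets_at_top \<Lambda>)"
      using D_has_sum by (intro tendsto_norm) (simp add: has_sum_def)
    then show "norm (D x) \<le> norm x * C"
      by (rule tendsto_upperbound) (auto intro!: eventually_finite_subsets_at_top_weakI fin)
  qed
qed

lemma symmetric_D: "inner (D x) y = inner x (D y)"
proof -
  have "l * inner (P l y) x = l * inner (P l x) y" if "l \<in> \<Lambda>" for l
    by (simp only: symmetric_P[OF that, of y x] inner_commute[of y])
  then have "((\<lambda>l. l * inner (P l x) y) has_sum inner (D y) x) \<Lambda>"
    by (rule has_sum_cong[THEN iffD1, OF _ D_inner_has_sum])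
  from has_sum_unique[OF D_inner_has_sum[of x y] this] show ?thesis
    by (simp only: inner_commute[of x])
qed

text \<open>By orthogonality and idempotence, applying \<open>P l\<close> before or after the series
  leaves only the term with index \<open>l\<close>.\<close>

lemma
  assumes l: "l \<in> \<Lambda>"
  shows P_D: "P l (D x) = l *\<^sub>R P l x" and D_P: "D (P l x) = l *\<^sub>R P l x"
proof -
  interpret P: bounded_linear "P l" by (rule bounded_linear_P[OF l])
  have "((\<lambda>m. P l (m *\<^sub>R P m x)) has_sum P l (D x)) \<Lambda>"
    by (rule has_sum_bounded_linear[OF P.bounded_linear_axioms D_has_sum])
  moreover have "((\<lambda>m. P l (m *\<^sub>R P m x)) has_sum (l *\<^sub>R P l x)) \<Lambda>"
    by (rule has_sum_finite_neutralI[of "{l}"]) (use l in \<open>auto simp: P.scaleR idem orth\<close>)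
  ultimately show "P l (D x) = l *\<^sub>R P l x" by (rule has_sum_unique)
  have "((\<lambda>m. m *\<^sub>R P m (P l x)) has_sum (l *\<^sub>R P l x)) \<Lambda>"
    by (rule has_sum_finite_neutralI[of "{l}"]) (use l in \<open>auto simp: idem orth\<close>)
  then show "D (P l x) = l *\<^sub>R P l x" using D_has_sum has_sum_unique by blast
qed

section \<open>An eigenvector at the bottom of the numerical range\<close>

lemma norm_minimum_attained:
  assumes K: "bounded_linear K" "\<And>x y. inner (K x) y = inner x (K y)" "\<And>x. 0 \<le> inner (K x) x"
      "compact (closure (K ` cball 0 1))" "\<And>l x. l \<in> \<Lambda> \<Longrightarrow> K (P l x) = P l (K x)"
    and T_def: "\<And>x. T x = D x - K x" and T_pos: "\<And>x. 0 \<le> inner (T x) x"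
    and wf: "\<And>S. S \<subseteq> \<Lambda> \<Longrightarrow> S \<noteq> {} \<Longrightarrow> \<exists>m\<in>S. \<forall>l\<in>S. m \<le> l"
    and M: "subspace M" "closed M" "M \<noteq> {0}" "\<And>x. x \<in> M \<Longrightarrow> T x \<in> M"
  shows "\<exists>z\<in>M. norm z = 1 \<and> (\<forall>x\<in>M. norm x = 1 \<longrightarrow> norm (T z) \<le> norm (T x))"
proof -
  interpret D: bounded_linear D by (rule bounded_linear_D)
  interpret K: bounded_linear K by (rule K)
  define Q where "Q = {inner (T x) x | x. x \<in> M \<and> norm x = 1}"
  define \<mu> where "\<mu> = Inf Q"
  obtain v where v: "v \<in> M" "v \<noteq> 0" using M(1,3) subspace_0 by blast
  have "sgn v \<in> M" using v M(1) by (simp add: sgn_div_norm subspace_scale)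
  then have Q: "Q \<noteq> {}" using v by (force simp: Q_def norm_sgn)
  have "bdd_below Q" using T_pos by (intro bdd_belowI[of _ 0]) (auto simp: Q_def)
  then have \<mu>_le1: "\<mu> \<le> inner (T x) x" if "x \<in> M" "norm x = 1" for x
    unfolding \<mu>_def using that by (intro cInf_lower) (auto simp: Q_def)
  have "\<mu> \<ge> 0" unfolding \<mu>_def using T_pos Q by (intro cInf_greatest) (auto simp: Q_def)
  define A where "A x = T x - \<mu> *\<^sub>R x" for x
  have A: "bounded_linear A"
    unfolding A_def T_def by (intro bounded_linear_intros D.bounded_linear_axioms K)
  obtain B where B: "B > 0" "\<And>x. norm (A x) \<le> norm x * B"
    using bounded_linear.pos_bounded[OF A] by blast
  \<comment> \<open>The step size is the inverse of a norm bound for \<open>A\<close>, which is what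
    \<open>small\<close> requires.\<close>
  interpret A: symmetric_operator A "inverse B"
    by (intro symmetric_operator.intro symmetric_operator_axioms.intro A)
      (use B in \<open>auto simp: A_def T_def inner_diff symmetric_D K inverse_eq_divide divide_le_eq\<close>)
  have A_M: "A x \<in> M" if "x \<in> M" for x
    unfolding A_def using that M by (intro subspace_diff subspace_scale) auto
  have A_inner: "inner (A x) x = inner (T x) x - \<mu>" if "norm x = 1" for x
    using that by (simp add: A_def inner_diff power2_norm_eq_inner[symmetric])
  have A_pos: "0 \<le> inner (A x) x" if "x \<in> M" for x
  proof (cases "x = 0")
    case False
    have "sgn x \<in> M" using that M(1) by (simp add: sgn_div_norm subspace_scale)
    moreover have n: "norm (sgn x) = 1" using False by (simp add: norm_sgn)
    ultimately have "0 \<le> inner (A (sgn x)) (sgn x)" using \<mu>_le1 by (simp add: A_inner)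
    then have "0 \<le> inner (A x) x / (norm x * norm x)"
      by (simp add: sgn_div_norm A.scaleR field_simps)
    then show ?thesis using False by (auto simp: zero_le_divide_iff mult_le_0_iff)
  qed simp
  have A_P: "A (P l x) = P l (A x)" if "l \<in> \<Lambda>" for l x
    using that linear_simps[OF bounded_linear_P[OF that]]
    by (simp add: A_def T_def K D_P P_D)
  have "\<exists>z\<in>M. norm z = 1 \<and> A z = 0"
  proof (cases "\<exists>l\<in>\<Lambda>. l \<le> \<mu> \<and> (\<exists>x\<in>M. P l x \<noteq> 0)")
    case True
    then obtain l x where l: "l \<in> \<Lambda>" "l \<le> \<mu>" and x: "x \<in> M" "P l x \<noteq> 0" by blast
    interpret P: bounded_linear "P l" by (rule bounded_linear_P[OF l(1)])
    have W: "subspace (range (P l))"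
      using linear_subspace_image[OF P.linear_axioms subspace_UNIV] .
    have W_A: "A y \<in> range (P l)" if "y \<in> range (P l)" for y
      using that by (auto simp: A_P[OF l(1)])
    have W_neg: "inner (A y) y \<le> 0" if "y \<in> range (P l)" for y
    proof -
      have "D y = l *\<^sub>R y" using that D_P[OF l(1)] by auto
      then have "inner (A y) y = (l - \<mu>) * inner y y - inner (K y) y"
        by (simp add: A_def T_def inner_diff algebra_simps)
      moreover have "(l - \<mu>) * inner y y \<le> 0" using l by (simp add: mult_nonpos_nonneg)
      ultimately show ?thesis using K(3)[of y] by simp
    qed
    \<comment> \<open>The intertwiner is \<open>P l\<close> itself, from \<open>M\<close>, where the
      form of \<open>A\<close> is nonnegative, to its range, where it is nonpositive. The result is
      the condition under which \<open>kernel_vector\<close> preserves the value of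
      \<open>P l\<close>.\<close>
    have "P l (A y) = 0" if "y \<in> M" for y
      using A.intertwiner_vanishes[OF M(1) A_M A_pos W W_A W_neg P.bounded_linear_axioms
          _ A_P[OF l(1), symmetric] that] A_P[OF l(1)] by simp
    then obtain z where z: "z \<in> M" "A z = 0" "P l z = P l x"
      using A.kernel_vector[OF M(1) A_M A_pos M(2) x(1) P.bounded_linear_axioms] by blast
    then have "z \<noteq> 0" using x P.zero by auto
    then show ?thesis
      using z M(1) by (intro bexI[of _ "sgn z"]) (auto simp: norm_sgn sgn_div_norm A.scaleR subspace_scale)
  next
    case False
    then have vanish: "P l x = 0" if "l \<in> \<Lambda>" "l \<le> \<mu>" "x \<in> M" for l x using that by blast
    \<comment> \<open>The gap above \<open>\<mu>\<close> comes from the least index exceeding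
      \<open>\<mu>\<close>. If there is none, the condition is vacuous and 1 is an arbitrary
      choice.\<close>
    obtain d where d: "d > 0" "\<And>l. l \<in> \<Lambda> \<Longrightarrow> \<mu> < l \<Longrightarrow> d \<le> l - \<mu>"
    proof (cases "{l \<in> \<Lambda>. \<mu> < l} = {}")
      case True
      then show ?thesis using that[of 1] by auto
    next
      case False
      then obtain m where "m \<in> \<Lambda>" "\<mu> < m" "\<And>l. l \<in> \<Lambda> \<Longrightarrow> \<mu> < l \<Longrightarrow> m \<le> l"
        using wf[of "{l \<in> \<Lambda>. \<mu> < l}"] by blast
      then show ?thesis using that[of "m - \<mu>"] by auto
    qed
    define G where "G x = D x - \<mu> *\<^sub>R x" for x
    have G: "bounded_linear G"
      unfolding G_def by (intro bounded_linear_intros D.bounded_linear_axioms)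
    \<comment> \<open>On \<open>M\<close> the components with index at most \<open>\<mu>\<close>
      vanish, and every other one contributes at least the gap \<open>d\<close> to the form of
      \<open>G\<close>. Cauchy-Schwarz turns the form bound into a norm bound.\<close>
    have below: "d * norm x \<le> norm (G x)" if "x \<in> M" for x
    proof (cases "x = 0")
      case False
      have "((\<lambda>l. d * (norm (P l x))\<^sup>2) has_sum (d * (norm x)\<^sup>2)) \<Lambda>"
        by (intro has_sum_cmult_right norm_sq_has_sum)
      moreover have "((\<lambda>l. l * (norm (P l x))\<^sup>2 + (- \<mu>) * (norm (P l x))\<^sup>2) has_sum
          (inner (D x) x + (- \<mu>) * (norm x)\<^sup>2)) \<Lambda>"
        by (intro has_sum_add has_sum_cmult_right D_inner_self_has_sum norm_sq_has_sum)
      moreover have "d * (norm (P l x))\<^sup>2 \<le> l * (norm (P l x))\<^sup>2 + (- \<mu>) * (norm (P l x))\<^sup>2"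
        if "l \<in> \<Lambda>" for l
      proof (cases "l \<le> \<mu>")
        case False
        then have "d * (norm (P l x))\<^sup>2 \<le> (l - \<mu>) * (norm (P l x))\<^sup>2"
          using d(2)[OF that] by (intro mult_right_mono) auto
        then show ?thesis by (simp add: algebra_simps)
      qed (simp add: vanish \<open>x \<in> M\<close> that)
      ultimately have "d * (norm x)\<^sup>2 \<le> inner (D x) x + (- \<mu>) * (norm x)\<^sup>2"
        by (rule has_sum_mono)
      also have "\<dots> = inner (G x) x" by (simp add: G_def inner_diff power2_norm_eq_inner)
      also have "\<dots> \<le> norm (G x) * norm x" by (rule norm_cauchy_schwarz)
      finally show ?thesis using False by (simp add: power2_eq_square)
    qed simp
    have "\<exists>x\<in>M. norm x = 1 \<and> inner (T x) x < \<mu> + inverse (real (Suc n))" for n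
      using cInf_lessD[OF Q, of "\<mu> + inverse (real (Suc n))"] by (auto simp: \<mu>_def Q_def)
    then obtain X where X: "\<And>n. X n \<in> M" "\<And>n. norm (X n) = 1"
        "\<And>n. inner (T (X n)) (X n) < \<mu> + inverse (real (Suc n))"
      by metis
    \<comment> \<open>A minimizing sequence only makes the form of \<open>A\<close> small;
      \<open>norm_A_sq_le\<close> upgrades this to smallness of \<open>A (X n)\<close> in
      norm.\<close>
    have "inverse B * (norm (A (X n)))\<^sup>2 \<le> inverse (real (Suc n))" for n
      using A.norm_A_sq_le[OF M(1) A_M A_pos X(1)] X(3)[of n] A_inner[OF X(2)] by (smt (verit))
    then have le: "(norm (A (X n)))\<^sup>2 \<le> B * inverse (real (Suc n))" for n
      using B(1) by (simp add: field_simps)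
    have "(\<lambda>n. (norm (A (X n)))\<^sup>2) \<longlonglongrightarrow> 0"
    proof (rule tendsto_sandwich[OF _ _ tendsto_const])
      show "(\<lambda>n. B * inverse (real (Suc n))) \<longlonglongrightarrow> 0"
        using tendsto_mult_left[OF LIMSEQ_inverse_real_of_nat, of B] by simp
    qed (use le in \<open>auto simp del: of_nat_Suc\<close>)
    then have "(\<lambda>n. norm (A (X n))) \<longlonglongrightarrow> 0"
      using tendsto_real_sqrt by fastforce
    moreover have "A x = G x - K x" for x by (simp add: A_def G_def T_def)
    ultimately have "(\<lambda>n. G (X n) - K (X n)) \<longlonglongrightarrow> 0"
      by (simp add: tendsto_norm_zero_iff)
    then obtain z where z: "z \<in> M" "norm z = 1" "G z = K z"
      using unit_kernel_vector_compact[OF G K(1,4) M(1,2) d(1) below X(1,2), of "\<lambda>n. n"] by blast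
    then show ?thesis by (intro bexI[of _ z]) (auto simp: A_def T_def G_def algebra_simps)
  qed
  then obtain z where z: "z \<in> M" "norm z = 1" "A z = 0" by blast
  \<comment> \<open>Since \<open>T z\<close> is \<open>\<mu>\<close> times \<open>z\<close> with
    \<open>\<mu>\<close> nonnegative, Cauchy-Schwarz passes from the minimum of the form to the
    minimum of the norm.\<close>
  have "norm (T z) \<le> norm (T x)" if "x \<in> M" "norm x = 1" for x
  proof -
    have "norm (T z) = \<mu>" using z \<open>\<mu> \<ge> 0\<close> by (simp add: A_def)
    also have "\<dots> \<le> inner (T x) x" by (rule \<mu>_le1[OF that])
    also have "\<dots> \<le> norm (T x)" using norm_cauchy_schwarz[of "T x" x] that by simp
    finally show ?thesis .
  qed
  then show ?thesis using z by blast
qed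

end

section \<open>Passage between the complex inner product and its real part\<close>

lemma norm_scaleC: "norm (c *\<^sub>C x) = cmod c * norm (x :: 'a::complex_inner)"
proof -
  have "complex_of_real ((norm (c *\<^sub>C x))\<^sup>2) = c * cnj (c * cinner x x)"
    by (metis cinner_self cinner_commute cinner_scaleC_left complex_cnj_cnj)
  also have "\<dots> = complex_of_real ((cmod c * norm x)\<^sup>2)"
    by (simp add: cinner_self power_mult_distrib complex_norm_square[unfolded of_real_power] flip: mult.assoc)
  finally have "(norm (c *\<^sub>C x))\<^sup>2 = (cmod c * norm x)\<^sup>2" by (rule of_real_eq_iff[THEN iffD1])
  then show ?thesis by (simp add: power2_eq_iff_nonneg)
qed

lemma bounded_linear_scaleC: "bounded_linear (scaleC c :: 'a::complex_inner \<Rightarrow> 'a)"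
proof (rule bounded_linear_intro)
  fix x :: 'a and r
  show "c *\<^sub>C r *\<^sub>R x = r *\<^sub>R c *\<^sub>C x"
    by (simp add: scaleC_of_real[symmetric] scaleC_scaleC mult.commute)
  show "norm (c *\<^sub>C x) \<le> norm x * cmod c" by (simp add: norm_scaleC)
qed (rule scaleC_add_right)

lemma Im_cinner: "Im (cinner x y) = - inner (\<i> *\<^sub>C x) y"
  by (simp add: Re_cinner[symmetric] cinner_scaleC_left)

lemma inner_i_right: "inner x (\<i> *\<^sub>C y) = - inner (\<i> *\<^sub>C x) y"
proof -
  have "inner x (\<i> *\<^sub>C y) = Im (cinner x y)"
    using cinner_commute[of x y] inner_commute[of x "\<i> *\<^sub>C y"]
    by (simp add: Re_cinner[symmetric] cinner_scaleC_left)
  then show ?thesis by (simp add: Im_cinner)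
qed

text \<open>Multiplication by \<open>\<i>\<close> is skew for the real inner product and commutes
  with \<open>T\<close>, so the imaginary part equals its own negative.\<close>

lemma cinner_self_symmetric_real:
  assumes "bounded_clinear T" "\<And>x y. inner (T x) y = inner x (T y)"
  shows "Im (cinner (T x) x) = 0"
proof -
  have "inner (\<i> *\<^sub>C T x) x = inner (T (\<i> *\<^sub>C x)) x"
    using assms(1) by (simp add: bounded_clinear_def)
  also have "\<dots> = inner (\<i> *\<^sub>C x) (T x)" by (rule assms)
  also have "\<dots> = - inner (\<i> *\<^sub>C T x) x" by (simp add: inner_commute[of _ "T x"] inner_i_right)
  finally show ?thesis by (simp add: Im_cinner)
qed

text \<open>Polarization at \<open>x + \<i> *\<^sub>C y\<close>: the diagonal terms vanish by
  assumption and the mixed terms express symmetry. This supplies the symmetry of \<open>K\<close>,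
  whose positivity is given only through its quadratic form.\<close>

lemma symmetric_of_cinner_self_real:
  assumes T: "bounded_clinear T" "\<And>x. Im (cinner (T x) x) = 0"
  shows "inner (T x) y = inner x (T y)"
proof -
  interpret bounded_linear T using T by (simp add: bounded_clinear_def)
  have Ti: "T (\<i> *\<^sub>C z) = \<i> *\<^sub>C T z" for z using T by (simp add: bounded_clinear_def)
  have i: "\<i> *\<^sub>C \<i> *\<^sub>C z = - z" for z :: 'a
    using scaleC_of_real[of "-1" z] by (simp add: scaleC_scaleC)
  have 0: "inner (\<i> *\<^sub>C T z) z = 0" for z using T(2)[of z] by (simp add: Im_cinner)
  have "inner (\<i> *\<^sub>C T (x + \<i> *\<^sub>C y)) (x + \<i> *\<^sub>C y) = 0" by (rule 0)
  then have "inner (\<i> *\<^sub>C T x) (\<i> *\<^sub>C y) - inner (T y) x = 0"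
    using 0[of x] 0[of "\<i> *\<^sub>C y"] by (simp add: add Ti scaleC_add_right inner_add_left inner_add_right inner_diff_left i)
  then show ?thesis by (simp add: inner_i_right i inner_commute)
qed

lemma nonneg_Reals_cinner_iff: "cinner x y \<in> \<real>\<^sub>\<ge>\<^sub>0 \<longleftrightarrow> 0 \<le> inner x y \<and> Im (cinner x y) = 0"
  by (auto simp: complex_nonneg_Reals_iff Re_cinner)

section \<open>Positivity of the difference and its minimum on each reducing subspace\<close>

theorem proposition5p2:
  fixes \<Lambda> :: "real set"
    and P :: "real \<Rightarrow> 'a::complex_hilbert \<Rightarrow> 'a"
    and K :: "'a \<Rightarrow> 'a"
  assumes infinite_dim: "\<not> (\<exists>B :: 'a set. finite B \<and> cspan B = UNIV)"
    and separable: "separable_space (euclidean :: 'a topology)"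
    and "\<Lambda> \<subseteq> {0..}" and "bounded \<Lambda>" and "countable \<Lambda>"
    and "well_order_on \<Lambda> {(x, y). x \<in> \<Lambda> \<and> y \<in> \<Lambda> \<and> x \<le> y}"
    and "\<And>l. l \<in> \<Lambda> \<Longrightarrow> is_projection (P l)"
    and "\<And>l m. l \<in> \<Lambda> \<Longrightarrow> m \<in> \<Lambda> \<Longrightarrow> l \<noteq> m \<Longrightarrow> P l \<circ> P m = (\<lambda>x. 0)"
    and "sot_has_sum P \<Lambda> (\<lambda>x. x)"
    and "positive_op K" and "compact_op K"
    and "\<And>l. l \<in> \<Lambda> \<Longrightarrow> K \<circ> P l = P l \<circ> K"
    and "\<And>l. l \<in> \<Lambda> \<Longrightarrow> op_le_on (range (P l)) K (\<lambda>x. l *\<^sub>R x)"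
  shows "\<exists>D. sot_has_sum (\<lambda>l x. l *\<^sub>R P l x) \<Lambda> D \<and>
    positive_op (\<lambda>x. D x - K x) \<and> (\<lambda>x. D x - K x) \<in> M_r"
proof -
  have P: "bounded_clinear (P l)" "P l \<circ> P l = P l" "cadjoint (P l) = P l" if "l \<in> \<Lambda>" for l
    using assms(7)[OF that] by (simp_all add: is_projection_def)
  interpret orthogonal_resolution \<Lambda> P
  proof (rule orthogonal_resolution.intro)
    fix l x y assume l: "l \<in> \<Lambda>"
    show "inner (P l x) y = inner x (P l y)"
      using cinner_cadjoint[OF P(1)[OF l], of x y] P(3)[OF l] by (metis Re_cinner)
  next
    fix l m x assume "l \<in> \<Lambda>" "m \<in> \<Lambda>" "l \<noteq> m"
    then show "P l (P m x) = 0" using assms(8) by (metis comp_apply)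
  next
    fix l x assume "l \<in> \<Lambda>"
    then show "P l (P l x) = P l x" using P(2) by (metis comp_apply)
  qed (use assms(4,9) P(1) in \<open>auto simp: sot_has_sum_def bounded_clinear_def\<close>)
  have K: "bounded_clinear K" "0 \<le> inner (K x) x" "Im (cinner (K x) x) = 0" for x
    using assms(10) by (auto simp: positive_op_def op_le_on_def nonneg_Reals_cinner_iff)
  then have K_lin: "bounded_linear K" by (simp add: bounded_clinear_def)
  have K_sym: "inner (K x) y = inner x (K y)" for x y
    by (rule symmetric_of_cinner_self_real[OF K(1,3)])
  have K_comp: "compact (closure (K ` cball 0 1))" using assms(11) by (simp add: compact_op_def)
  have K_P: "K (P l x) = P l (K x)" if "l \<in> \<Lambda>" for l x using assms(12)[OF that] by (metis comp_apply)
  have K_le: "inner (K (P l x)) (P l x) \<le> l * (norm (P l x))\<^sup>2" if "l \<in> \<Lambda>" for l x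
    using assms(13)[OF that]
    by (simp add: op_le_on_def nonneg_Reals_cinner_iff inner_diff power2_norm_eq_inner)
  define T where "T x = D x - K x" for x
  \<comment> \<open>So far \<open>D\<close> is only real linear. Complex scalars pass through each
    term of the series, and sums are unique.\<close>
  have "D (c *\<^sub>C x) = c *\<^sub>C D x" for c x
  proof -
    have "((\<lambda>l. c *\<^sub>C (l *\<^sub>R P l x)) has_sum c *\<^sub>C D x) \<Lambda>"
      by (rule has_sum_bounded_linear[OF bounded_linear_scaleC D_has_sum])
    moreover have "c *\<^sub>C (l *\<^sub>R P l x) = l *\<^sub>R P l (c *\<^sub>C x)" if "l \<in> \<Lambda>" for l
      using P(1)[OF that] by (simp add: bounded_clinear_def scaleC_of_real[symmetric] scaleC_scaleC mult.commute)
    ultimately have "((\<lambda>l. l *\<^sub>R P l (c *\<^sub>C x)) has_sum c *\<^sub>C D x) \<Lambda>"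
      by (simp cong: has_sum_cong)
    then show ?thesis using D_has_sum has_sum_unique by blast
  qed
  then have T: "bounded_clinear T"
    using K(1) bounded_linear_D unfolding bounded_clinear_def T_def
    by (auto intro: bounded_linear_sub simp: complex_vector.scale_right_diff_distrib)
  have T_sym: "inner (T x) y = inner x (T y)" for x y
    by (simp add: T_def inner_diff symmetric_D K_sym)
  have T_pos: "0 \<le> inner (T x) x" for x
  \<comment> \<open>The form of \<open>K\<close> splits along the resolution: because
    \<open>K\<close> commutes with \<open>P l\<close>, the term with index \<open>l\<close> is the
    form of \<open>K\<close> at \<open>P l x\<close>, which is compared with the matching term of
    the form of \<open>D\<close>.\<close>
  proof -
    have "((\<lambda>l. inner (P l x) (K x)) has_sum inner x (K x)) \<Lambda>"
      by (rule has_sum_bounded_linear[OF bounded_linear_inner_left P_has_sum])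
    moreover have "inner (P l x) (K x) \<le> l * (norm (P l x))\<^sup>2" if "l \<in> \<Lambda>" for l
      using K_le[OF that, of x] that by (metis K_P idem symmetric_P inner_commute)
    ultimately have "inner x (K x) \<le> inner (D x) x"
      by (intro has_sum_mono[OF _ D_inner_self_has_sum])
    then show ?thesis by (simp add: T_def inner_diff inner_commute)
  qed
  have wf: "\<exists>m\<in>S. \<forall>l\<in>S. m \<le> l" if S: "S \<subseteq> \<Lambda>" "S \<noteq> {}" for S
  proof -
    \<comment> \<open>The strict part of the order is well-founded, and a minimal element of
      \<open>S\<close> is least because real numbers are linearly ordered.\<close>
    have "wf ({(x, y). x \<in> \<Lambda> \<and> y \<in> \<Lambda> \<and> x \<le> y} - Id)" using assms(6) by (simp add: well_order_on_def)
    moreover obtain v where "v \<in> S" using S(2) by blast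
    ultimately obtain m where m: "m \<in> S"
        "\<And>y. (y, m) \<in> {(x, y). x \<in> \<Lambda> \<and> y \<in> \<Lambda> \<and> x \<le> y} - Id \<Longrightarrow> y \<notin> S"
      by (rule wfE_min) blast
    have "m \<le> l" if "l \<in> S" for l 
    proof (rule ccontr)
      assume "\<not> m \<le> l"
      then have "(l, m) \<in> {(x, y). x \<in> \<Lambda> \<and> y \<in> \<Lambda> \<and> x \<le> y} - Id" using m(1) that S(1) by auto
      then show False using m(2) that by blast
    qed
    then show ?thesis using m(1) by blast
  qed
  have "min_attaining_on M T" if M: "csubspace M" "closed M" "M \<noteq> {0}" "reduces M T" for M
  proof -
    have "subspace M"
      unfolding subspace_def
      using complex_vector.subspace_0[OF M(1)] complex_vector.subspace_add[OF M(1)]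
        complex_vector.subspace_scale[OF M(1)] by (metis scaleC_of_real)
    moreover have "\<And>x. x \<in> M \<Longrightarrow> T x \<in> M" using M(4) by (auto simp: reduces_def)
    ultimately obtain z where z: "z \<in> M" "norm z = 1"
        "\<And>x. x \<in> M \<Longrightarrow> norm x = 1 \<Longrightarrow> norm (T z) \<le> norm (T x)"
      using norm_minimum_attained[OF K_lin K_sym K(2) K_comp K_P T_def T_pos wf _ M(2,3)] by blast
    then have "min_modulus_on M T = norm (T z)"
      unfolding min_modulus_on_def by (intro cInf_eq_minimum) auto
    then show ?thesis using z by (auto simp: min_attaining_on_def)
  qed
  then have "T \<in> M_r" using T by (simp add: M_r_def)
  moreover have "positive_op T"
    using T T_pos cinner_self_symmetric_real[OF T T_sym]
    by (simp add: positive_op_def op_le_on_def nonneg_Reals_cinner_iff)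
  moreover have "sot_has_sum (\<lambda>l x. l *\<^sub>R P l x) \<Lambda> D"
    by (simp add: sot_has_sum_def D_has_sum)
  ultimately show ?thesis unfolding T_def[abs_def] by blast
qed

end
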